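(* Let $\mathcal{P}=(V,E,r,\mu,\delta)$ be an optimistic fair DAG MPCS protocol for a contract $\mathfrak{C}$ with finite set of signers $A$, and let $k=|A|$. Let $$I=\{v\in\mathit{InitSet}(\mathcal{P}) : \text{for all } w,\ (v\prec w\ \wedge\ r(v)=r(w))\Rightarrow w\notin\mathit{InitSet}(\mathcal{P})\}.$$ If $v\in\mathit{SigSet}(\mathcal{P})$, then for every permutation $(P_1,\dots,P_{k-1})$ of the signers in $A\setminus\{r(v)\}$ there exists a sequence in $\mathrm{seq}(I,v)$ which contains $(P_1,\dots,P_{k-1})$ as a (not necessarily consecutive) subsequence.
   Context: **Causality.** For a finite directed acyclic graph $(V,E)$ and $v,w\in V$, $v\prec w$ means there is a directed path (of length $\ge 1$) from $v$ to $w$; $v\preceq w$ means $v\prec w$ or $v=w$. This extends to $V\cup E$: $(v,w)\prec(v',w')$ iff $w\preceq v'$; $v\prec(v',w')$ iff $v\preceq v'$; $(v,w)\prec v'$ iff $w\preceq v'$. A set $S\subseteq V\cup E$ is causally closed if $x\in S$ and $y\prec x$ imply $y\in S$. $\mathrm{in}(v)$ is the set of edges with target $v$. **Paths.** For $I\subseteq V$, $v\in V$: $\mathrm{path}(I,v)$ is the set of sequences $(v_1,\dots,v_m)$ of vertices with $v_1\in I$, $v_m=v$ and $(v_i,v_{i+1})\in E$ for $1\le i<m$; $\mathrm{seq}(I,v)$ is the set of role sequences $(r(v_1),\dots,r(v_m))$ with $(v_1,\dots,v_m)\in\mathrm{path}(I,v)$. **DAG protocol specification.** Let $R$ be a set of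 roles, $T\notin R$ the trusted third party (TTP), $M$ a set of messages, $\varepsilon,\mathit{exit}\notin M$ two symbols. A DAG protocol specification is $\mathcal{P}=(V,E,r,\mu,\delta)$ with $(V,E)$ a finite DAG, $r:V\to R\cup\{T\}$, $\mu:E\to M\cup\{\varepsilon,\mathit{exit}\}$ such that $\mu(v,v')=\varepsilon$ implies $r(v)=r(v')$ and $\mu(v,v')=\mathit{exit}$ implies $r(v')=T$, and $\delta:M^*\to M$ a function giving the replies of the TTP. Edges with label in $M$ are message edges. **DAG MPCS protocol specification.** Let $A\subset R$ be a finite set of signers, $\mathfrak{C}$ a contract, $\mathit{SigSet}\subseteq V$. $\mathcal{P}$ is a DAG MPCS protocol (specification) for $\mathfrak{C}$ if: 1. there is a unique $v_T\in V$ with $r(v_T)=T$, $(v,v_T)\in E$ for all $v\in V\setminus\{v_T\}$, and $r(v)\in A$ for $v\ne v_T$; 2. for all $v,w\in V$: if $v\prec w$ then $(v,w)\in E$ or there is $u\in V$ with $v\prec u\prec w$ and $r(u)\in\{r(v),r(w)\}$; 3. for $(v,w)\in E$: $\mu(v,w)=\varepsilon$ if $r(v)=r(w)$; $\mu(v,w)=\mathit{exit}$ if $w=v_T$; $\mu(v,w)$ is the signature $\mathcal{S}_{r(v)}(\mathfrak{C})$ if $v\in\mathit{SigSet}$ and $r(v)\ne r(w)\ne T$; otherwise $\mu(v,w)$ is the promise $\wp_{r(v)}(\mathfrak{C},v,r(w),T)$ (both kinds are elements of $M$); 4. $\delta$ takes values in $\{\text{"abort"},(\mathcal{S}_Q(\mathfrak{C}))_{Q\in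 A}\}$ and is given by the TTP procedure below. $\mathit{SigSet}(\mathcal{P})$ is the set of $v\in\mathit{SigSet}$ having at least one outgoing message edge. For $v\in V\setminus\{v_T\}$: $K(v)=\{(w,v')\in E: \mu(w,v')\in M,\ v'\preceq v,\ r(v')=r(v)\}$ and $K_\prec(v)=\{(w,v')\in K(v): v'\prec v\}$; $K_\prec(S)=\bigcup_{v\in S}K_\prec(v)$. $v\in\mathit{InitSet}(\mathcal{P})$ iff $\{r(w): (w,v')\in K_\prec(v)\}\cup\{r(v)\}\neq A$. $v\in\mathit{EndSet}(\mathcal{P})$ iff $\{r(w): (w,v')\in K(v),\ w\in\mathit{SigSet}(\mathcal{P})\}\cup\{r(v)\}=A$. **TTP procedure.** Taking the exit edge $(v,v_T)$ means that signer $r(v)$ sends to $T$ the message $p_v$ consisting of the promise $\wp_{r(v)}(\mathfrak{C},v,r(v),T)$ and the list of labels of all edges in $K_\prec(v)$. $T$ keeps sets $J\subseteq V$, $\mathit{Dishonest}\subseteq A$ (initially empty) and a value $\mathit{decision}$ (initially "abort"). On receiving $p_v$ from $P=r(v)$: (a) if $P\in\mathit{Dishonest}$ or some $w'\in J$ has $r(w')=P$, add $P$ to $\mathit{Dishonest}$ and reply "abort"; (b) otherwise put $J:=J\cup\{v\}$; if $v\notin\mathit{InitSet}(\mathcal{P})$, then first for every $w\in J$ for which there is $(w',x)\in K_\prec(J)$ with $w\prec(w',x)$ and $r(w')=r(w)$, add $r(w)$ to $\mathit{Dishonest}$, and afterwards, if every $w\in J$ with $r(w)\notin\mathit{Dishonest}$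 has $r(w)=P$, set $\mathit{decision}:=(\mathcal{S}_Q(\mathfrak{C}))_{Q\in A}$; finally reply $\mathit{decision}$. $\delta(m_1,\dots,m_n)$ is the reply to the last message of the sequence. (Malformed messages are answered by "abort".) **Executions.** A state is a set $s\subseteq V\cup E$; the initial state is $s_0=\emptyset$. Transitions $s\to s'$ with $s\ne s'$ are: ($\mathit{recv}$) $s'=s\cup\{v\}$ with $v\in V$, $\mathrm{in}(v)\subseteq s$; ($\mathit{send}$) $s'=s\cup\{e\}$ with $\mu(e)\in M$; ($\varepsilon$) $s'=s\cup\{e\}$ with $e=(v,v')$, $\mu(e)=\varepsilon$, $v\in s$; ($\mathit{exit}$) $s'=s\cup\{e\}$ with $\mu(e)=\mathit{exit}$, $e=(v,v_T)$, where $r(v)$ has executed all receive events causally preceding $v$, i.e. every $v'\prec v$ with $r(v')=r(v)$ lies in $s$. An execution is a finite sequence of states and transition labels $[s_0,\alpha_1,s_1,\dots,\alpha_l,s_l]$ starting in $s_0$ whose consecutive states are related by transitions. It is closed if all its states are causally closed, it contains no exit transition, and it cannot be extended by any non-exit transition. **Optimistic.** $\mathcal{P}$ is optimistic if its execution with all signers honest, without failures and without involvement of $T$, gives every signer all signatures: the final state of every closed execution contains, for each $P\in A$, some $v\in\mathit{EndSet}(\mathcal{P})$ with $r(v)=P$. **Honesty.** For a role $P$ let $E_P$ be the set of edges having an endpoint of role $P$, and $V_P$ the set of endpoints of edges in $E_P$. Signer $P$ is honest in an execution if for every state $s_i$ of it the set $s=s_i\cap(V_P\cup E_P)$ satisfies,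 with causal closedness taken in the graph $(V_P,E_P)$: (1) $s$ contains at most one exit edge; (2) if $s$ contains no exit edge, $s$ is causally closed; (3) if $s$ contains an exit edge $e=(v,w)$, then $v\notin s$ and $s\setminus\{e\}$ is causally closed. **Fairness.** An execution with final state $s_n$ is fair for signer $P$ if at least one of the following holds: (i) no reply of $T$ in the execution is a list of signatures, and no message edge $(v,w)\in s_n$ with $r(v)=P$ has $v\in\mathit{SigSet}(\mathcal{P})$; (ii) there is $v\in s_n\cap\mathit{EndSet}(\mathcal{P})$ with $r(v)=P$; (iii) $P$ has not received "abort" from $T$, i.e. for each exit edge $(v,v_T)\in s_n$ with $r(v)=P$, the reply of $T$ at the moment this edge was executed is not "abort". $\mathcal{P}$ is fair if every execution is fair for every signer that is honest in it. *)

theory Defs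
  imports "HOL-Library.Sublist" "HOL-Combinatorics.Multiset_Permutations"
begin

section \<open>Causality\<close>

datatype 'v event = Vertex 'v | Arc "'v \<times> 'v"

definition events :: "'v set \<Rightarrow> ('v \<times> 'v) set \<Rightarrow> 'v event set" where
  "events V E = Vertex ` V \<union> Arc ` E"

text \<open>
  For a graph whose arcs are \<open>E\<close>, the relation \<open>prec E\<close> is only meaningful on the events of the
  graph, so it is always used relativised to \<open>events V E\<close>.
\<close>

fun prec :: "('v \<times> 'v) set \<Rightarrow> 'v event \<Rightarrow> 'v event \<Rightarrow> bool" where
  "prec E (Vertex v) (Vertex w) \<longleftrightarrow> (v, w) \<in> E\<^sup>+"
| "prec E (Arc (v, w)) (Arc (v', w')) \<longleftrightarrow> (w, v') \<in> E\<^sup>*"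
| "prec E (Vertex v) (Arc (v', w')) \<longleftrightarrow> (v, v') \<in> E\<^sup>*"
| "prec E (Arc (v, w)) (Vertex v') \<longleftrightarrow> (w, v') \<in> E\<^sup>*"

definition causally_closed :: "'v set \<Rightarrow> ('v \<times> 'v) set \<Rightarrow> 'v event set \<Rightarrow> bool" where
  "causally_closed V E S \<longleftrightarrow>
     S \<subseteq> events V E \<and> (\<forall>x\<in>S. \<forall>y\<in>events V E. prec E y x \<longrightarrow> y \<in> S)"


section \<open>DAG protocol specifications\<close>

text \<open>The set of messages is the type \<open>'m\<close>, so the two extra labels are never messages.\<close>

datatype 'm label = Msg (msg_of: 'm) | Epsilon | Exit

record ('v, 'r, 'm) dag_protocol =
  roles :: "'r set"
  ttp :: 'r
  verts :: "'v set"
  edges :: "('v \<times> 'v) set"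
  role :: "'v \<Rightarrow> 'r"
  label :: "'v \<times> 'v \<Rightarrow> 'm label"
  reply :: "'m list \<Rightarrow> 'm"

definition dag_protocol_spec :: "('v, 'r, 'm, 'z) dag_protocol_scheme \<Rightarrow> bool" where
  "dag_protocol_spec P \<longleftrightarrow>
     ttp P \<notin> roles P \<and>
     finite (verts P) \<and> edges P \<subseteq> verts P \<times> verts P \<and> acyclic (edges P) \<and>
     role P ` verts P \<subseteq> roles P \<union> {ttp P} \<and>
     (\<forall>(v, w)\<in>edges P. label P (v, w) = Epsilon \<longrightarrow> role P v = role P w) \<and>
     (\<forall>(v, w)\<in>edges P. label P (v, w) = Exit \<longrightarrow> role P w = ttp P)"

definition message_edges :: "('v, 'r, 'm, 'z) dag_protocol_scheme \<Rightarrow> ('v \<times> 'v) set" where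
  "message_edges P = {e \<in> edges P. \<exists>m. label P e = Msg m}"

definition exit_edges :: "('v, 'r, 'm, 'z) dag_protocol_scheme \<Rightarrow> ('v \<times> 'v) set" where
  "exit_edges P = {e \<in> edges P. label P e = Exit}"

definition in_edges :: "('v, 'r, 'm, 'z) dag_protocol_scheme \<Rightarrow> 'v \<Rightarrow> ('v \<times> 'v) set" where
  "in_edges P v = {e \<in> edges P. snd e = v}"

definition path :: "('v, 'r, 'm, 'z) dag_protocol_scheme \<Rightarrow> 'v set \<Rightarrow> 'v \<Rightarrow> 'v list set" where
  "path P I v = {vs. vs \<noteq> [] \<and> set vs \<subseteq> verts P \<and> hd vs \<in> I \<and> last vs = v \<and>
     successively (\<lambda>x y. (x, y) \<in> edges P) vs}"

definition seq :: "('v, 'r, 'm, 'z) dag_protocol_scheme \<Rightarrow> 'v set \<Rightarrow> 'v \<Rightarrow> 'r list set" where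
  "seq P I v = map (role P) ` path P I v"

definition ttp_vertex :: "('v, 'r, 'm, 'z) dag_protocol_scheme \<Rightarrow> 'v" where
  "ttp_vertex P = (THE v. v \<in> verts P \<and> role P v = ttp P)"


section \<open>Multi-party contract signing protocols\<close>

text \<open>
  Messages are symbolic terms. \<open>Sig Q c\<close> is the signature of \<open>Q\<close> on \<open>c\<close>, and
  \<open>Promise Q c v Q' T\<close> is the promise of \<open>Q\<close> on \<open>c\<close> for the vertex \<open>v\<close> addressed to \<open>Q'\<close> with
  trusted third party \<open>T\<close>. \<open>Family\<close> is a family of messages indexed by roles; the index set is
  the domain of the partial function. \<open>Atom\<close> stands for all further messages.
\<close>

datatype ('r, 'v, 'c, 'a) msg =
  Atom 'a
| Abort
| Sig 'r 'c
| Promise 'r 'c 'v 'r 'r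
| Tuple "('r, 'v, 'c, 'a) msg list"
| Family "'r \<Rightarrow> ('r, 'v, 'c, 'a) msg option"

record ('v, 'r, 'c, 'a) mpcs = "('v, 'r, ('r, 'v, 'c, 'a) msg) dag_protocol" +
  signers :: "'r set"
  contract :: 'c
  sigset :: "'v set"

definition SigSet :: "('v, 'r, 'c, 'a) mpcs \<Rightarrow> 'v set" where
  "SigSet P = {v \<in> sigset P. \<exists>w. (v, w) \<in> message_edges P}"

definition K :: "('v, 'r, 'c, 'a) mpcs \<Rightarrow> 'v \<Rightarrow> ('v \<times> 'v) set" where
  "K P v = {(w, v'). (w, v') \<in> message_edges P \<and> (v', v) \<in> (edges P)\<^sup>* \<and> role P v' = role P v}"

definition K_prec :: "('v, 'r, 'c, 'a) mpcs \<Rightarrow> 'v \<Rightarrow> ('v \<times> 'v) set" where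
  "K_prec P v = {(w, v'). (w, v') \<in> K P v \<and> (v', v) \<in> (edges P)\<^sup>+}"

definition InitSet :: "('v, 'r, 'c, 'a) mpcs \<Rightarrow> 'v set" where
  "InitSet P = {v \<in> verts P - {ttp_vertex P}.
     {role P w | w v'. (w, v') \<in> K_prec P v} \<union> {role P v} \<noteq> signers P}"

definition EndSet :: "('v, 'r, 'c, 'a) mpcs \<Rightarrow> 'v set" where
  "EndSet P = {v \<in> verts P - {ttp_vertex P}.
     {role P w | w v'. (w, v') \<in> K P v \<and> w \<in> SigSet P} \<union> {role P v} = signers P}"

definition all_signatures :: "('v, 'r, 'c, 'a) mpcs \<Rightarrow> ('r, 'v, 'c, 'a) msg" where
  "all_signatures P = Family (\<lambda>Q. if Q \<in> signers P then Some (Sig Q (contract P)) else None)"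

definition edge_label ::
    "('v, 'r, 'c, 'a) mpcs \<Rightarrow> 'v \<Rightarrow> 'v \<Rightarrow> ('r, 'v, 'c, 'a) msg label" where
  "edge_label P v w =
     (if role P v = role P w then Epsilon
      else if w = ttp_vertex P then Exit
      else if v \<in> sigset P \<and> role P w \<noteq> ttp P then Msg (Sig (role P v) (contract P))
      else Msg (Promise (role P v) (contract P) v (role P w) (ttp P)))"


subsection \<open>The procedure of the trusted third party\<close>

text \<open>
  The message that is sent when the exit edge at \<open>v\<close> is taken. The order in which the labels are
  listed is immaterial but fixed for each vertex, hence the choice of an enumeration.
\<close>

definition exit_msg :: "('v, 'r, 'c, 'a) mpcs \<Rightarrow> 'v \<Rightarrow> ('r, 'v, 'c, 'a) msg" where
  "exit_msg P v = Tuple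
     [Promise (role P v) (contract P) v (role P v) (ttp P),
      Tuple (map (\<lambda>e. msg_of (label P e)) (SOME es. distinct es \<and> set es = K_prec P v))]"

record ('v, 'r, 'm) ttp_state =
  received :: "'v set"
  dishonest :: "'r set"
  decision :: 'm

definition ttp_init :: "('v, 'r, ('r, 'v, 'c, 'a) msg) ttp_state" where
  "ttp_init = \<lparr>received = {}, dishonest = {}, decision = Abort\<rparr>"

definition ttp_handle :: "('v, 'r, 'c, 'a) mpcs \<Rightarrow> ('v, 'r, ('r, 'v, 'c, 'a) msg) ttp_state \<Rightarrow> 'v \<Rightarrow>
    ('v, 'r, ('r, 'v, 'c, 'a) msg) ttp_state \<times> ('r, 'v, 'c, 'a) msg" where
  "ttp_handle P st v =
     (let Q = role P v in
      if Q \<in> dishonest st \<or> (\<exists>w'\<in>received st. role P w' = Q)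
      then (st\<lparr>dishonest := dishonest st \<union> {Q}\<rparr>, Abort)
      else
        let J = received st \<union> {v} in
        if v \<in> InitSet P then (st\<lparr>received := J\<rparr>, decision st)
        else
          let D = dishonest st \<union>
                {role P w | w. w \<in> J \<and>
                   (\<exists>(w', x) \<in> (\<Union>u\<in>J. K_prec P u).
                      prec (edges P) (Vertex w) (Arc (w', x)) \<and> role P w' = role P w)};
              d = (if \<forall>w\<in>J. role P w \<notin> D \<longrightarrow> role P w = Q then all_signatures P else decision st)
          in (\<lparr>received = J, dishonest = D, decision = d\<rparr>, d))"

text \<open>
  A well-formed message determines its vertex, because the vertex is a component of the promise.
\<close>

definition ttp_step :: "('v, 'r, 'c, 'a) mpcs \<Rightarrow> ('v, 'r, ('r, 'v, 'c, 'a) msg) ttp_state \<Rightarrow>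
    ('r, 'v, 'c, 'a) msg \<Rightarrow>
    ('v, 'r, ('r, 'v, 'c, 'a) msg) ttp_state \<times> ('r, 'v, 'c, 'a) msg" where
  "ttp_step P st m =
     (if \<exists>v\<in>verts P - {ttp_vertex P}. m = exit_msg P v
      then ttp_handle P st (THE v. v \<in> verts P - {ttp_vertex P} \<and> m = exit_msg P v)
      else (st, Abort))"

definition ttp_run :: "('v, 'r, 'c, 'a) mpcs \<Rightarrow> ('r, 'v, 'c, 'a) msg list \<Rightarrow>
    ('v, 'r, ('r, 'v, 'c, 'a) msg) ttp_state" where
  "ttp_run P ms = foldl (\<lambda>st m. fst (ttp_step P st m)) ttp_init ms"

definition ttp_answer ::
    "('v, 'r, 'c, 'a) mpcs \<Rightarrow> ('r, 'v, 'c, 'a) msg list \<Rightarrow> ('r, 'v, 'c, 'a) msg" where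
  "ttp_answer P ms = snd (ttp_step P (ttp_run P (butlast ms)) (last ms))"


subsection \<open>Protocol specification\<close>

definition dag_mpcs_protocol :: "('v, 'r, 'c, 'a) mpcs \<Rightarrow> bool" where
  "dag_mpcs_protocol P \<longleftrightarrow>
     dag_protocol_spec P \<and>
     signers P \<subseteq> roles P \<and> finite (signers P) \<and> sigset P \<subseteq> verts P \<and>
     (\<exists>!v. v \<in> verts P \<and> role P v = ttp P) \<and>
     (\<forall>v\<in>verts P - {ttp_vertex P}. (v, ttp_vertex P) \<in> edges P \<and> role P v \<in> signers P) \<and>
     (\<forall>v\<in>verts P. \<forall>w\<in>verts P. (v, w) \<in> (edges P)\<^sup>+ \<longrightarrow>
        (v, w) \<in> edges P \<or>
        (\<exists>u\<in>verts P. (v, u) \<in> (edges P)\<^sup>+ \<and> (u, w) \<in> (edges P)\<^sup>+ \<and>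
           role P u \<in> {role P v, role P w})) \<and>
     (\<forall>(v, w)\<in>edges P. label P (v, w) = edge_label P v w) \<and>
     (\<forall>ms. reply P ms \<in> {Abort, all_signatures P}) \<and>
     (\<forall>ms. ms \<noteq> [] \<longrightarrow> reply P ms = ttp_answer P ms)"


section \<open>Executions\<close>

datatype 'v transition =
  Recv 'v | Send "'v \<times> 'v" | EpsilonStep "'v \<times> 'v" | is_ExitStep: ExitStep "'v \<times> 'v"

fun enabled :: "('v, 'r, 'c, 'a) mpcs \<Rightarrow> 'v event set \<Rightarrow> 'v transition \<Rightarrow> bool" where
  "enabled P s (Recv v) \<longleftrightarrow> v \<in> verts P \<and> Arc ` in_edges P v \<subseteq> s"
| "enabled P s (Send e) \<longleftrightarrow> e \<in> message_edges P"
| "enabled P s (EpsilonStep e) \<longleftrightarrow> e \<in> edges P \<and> label P e = Epsilon \<and> Vertex (fst e) \<in> s"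
| "enabled P s (ExitStep e) \<longleftrightarrow> e \<in> exit_edges P \<and> snd e = ttp_vertex P \<and>
     (\<forall>v'\<in>verts P. (v', fst e) \<in> (edges P)\<^sup>+ \<and> role P v' = role P (fst e) \<longrightarrow> Vertex v' \<in> s)"

fun event_of :: "'v transition \<Rightarrow> 'v event" where
  "event_of (Recv v) = Vertex v"
| "event_of (Send e) = Arc e"
| "event_of (EpsilonStep e) = Arc e"
| "event_of (ExitStep e) = Arc e"

definition step ::
    "('v, 'r, 'c, 'a) mpcs \<Rightarrow> 'v event set \<Rightarrow> 'v transition \<Rightarrow> 'v event set \<Rightarrow> bool" where
  "step P s a s' \<longleftrightarrow> s \<noteq> s' \<and> enabled P s a \<and> s' = s \<union> {event_of a}"

text \<open>
  The execution \<open>[s\<^sub>0, \<alpha>\<^sub>1, s\<^sub>1, \<dots>, \<alpha>\<^sub>l, s\<^sub>l]\<close> is given by the list \<open>ss\<close> of its \<open>l + 1\<close> states and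
  the list \<open>as\<close> of its \<open>l\<close> transitions; \<open>as ! i\<close> leads from \<open>ss ! i\<close> to \<open>ss ! Suc i\<close>.
\<close>

definition execution ::
    "('v, 'r, 'c, 'a) mpcs \<Rightarrow> 'v event set list \<Rightarrow> 'v transition list \<Rightarrow> bool" where
  "execution P ss as \<longleftrightarrow>
     length ss = Suc (length as) \<and> ss ! 0 = {} \<and>
     (\<forall>i<length as. step P (ss ! i) (as ! i) (ss ! Suc i))"

definition closed_execution ::
    "('v, 'r, 'c, 'a) mpcs \<Rightarrow> 'v event set list \<Rightarrow> 'v transition list \<Rightarrow> bool" where
  "closed_execution P ss as \<longleftrightarrow>
     execution P ss as \<and>
     (\<forall>s\<in>set ss. causally_closed (verts P) (edges P) s) \<and>
     (\<forall>a\<in>set as. \<not> is_ExitStep a) \<and>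
     \<not> (\<exists>a s'. \<not> is_ExitStep a \<and> step P (last ss) a s')"

text \<open>
  The reply to the exit message that is sent by the transition \<open>as ! i\<close>, which is meant to be an
  exit transition.
\<close>

definition reply_at ::
    "('v, 'r, 'c, 'a) mpcs \<Rightarrow> 'v transition list \<Rightarrow> nat \<Rightarrow> ('r, 'v, 'c, 'a) msg" where
  "reply_at P as i = reply P [exit_msg P v. ExitStep (v, w) \<leftarrow> take (Suc i) as]"


section \<open>Optimism, honesty and fairness\<close>

definition optimistic :: "('v, 'r, 'c, 'a) mpcs \<Rightarrow> bool" where
  "optimistic P \<longleftrightarrow>
     (\<forall>ss as. closed_execution P ss as \<longrightarrow>
        (\<forall>Q\<in>signers P. \<exists>v\<in>EndSet P. Vertex v \<in> last ss \<and> role P v = Q))"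

definition edges_of :: "('v, 'r, 'c, 'a) mpcs \<Rightarrow> 'r \<Rightarrow> ('v \<times> 'v) set" where
  "edges_of P Q = {(v, w) \<in> edges P. role P v = Q \<or> role P w = Q}"

definition verts_of :: "('v, 'r, 'c, 'a) mpcs \<Rightarrow> 'r \<Rightarrow> 'v set" where
  "verts_of P Q = fst ` edges_of P Q \<union> snd ` edges_of P Q"

definition honest_state :: "('v, 'r, 'c, 'a) mpcs \<Rightarrow> 'r \<Rightarrow> 'v event set \<Rightarrow> bool" where
  "honest_state P Q t \<longleftrightarrow>
     (let VQ = verts_of P Q; EQ = edges_of P Q; s = t \<inter> events VQ EQ in
      (\<forall>e\<in>exit_edges P. \<forall>e'\<in>exit_edges P. Arc e \<in> s \<and> Arc e' \<in> s \<longrightarrow> e = e') \<and>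
      ((\<forall>e\<in>exit_edges P. Arc e \<notin> s) \<longrightarrow> causally_closed VQ EQ s) \<and>
      (\<forall>(v, w)\<in>exit_edges P. Arc (v, w) \<in> s \<longrightarrow>
         Vertex v \<notin> s \<and> causally_closed VQ EQ (s - {Arc (v, w)})))"

definition honest :: "('v, 'r, 'c, 'a) mpcs \<Rightarrow> 'r \<Rightarrow> 'v event set list \<Rightarrow> bool" where
  "honest P Q ss \<longleftrightarrow> (\<forall>s\<in>set ss. honest_state P Q s)"

definition fair_for ::
    "('v, 'r, 'c, 'a) mpcs \<Rightarrow> 'r \<Rightarrow> 'v event set list \<Rightarrow> 'v transition list \<Rightarrow> bool" where
  "fair_for P Q ss as \<longleftrightarrow>
     ((\<forall>i<length as. is_ExitStep (as ! i) \<longrightarrow> reply_at P as i \<noteq> all_signatures P) \<and>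
      (\<forall>(v, w)\<in>message_edges P. Arc (v, w) \<in> last ss \<and> role P v = Q \<longrightarrow> v \<notin> SigSet P)) \<or>
     (\<exists>v\<in>EndSet P. Vertex v \<in> last ss \<and> role P v = Q) \<or>
     (\<forall>(v, w)\<in>exit_edges P. Arc (v, w) \<in> last ss \<and> role P v = Q \<longrightarrow>
        (\<forall>i<length as. as ! i = ExitStep (v, w) \<longrightarrow> reply_at P as i \<noteq> Abort))"

definition fair :: "('v, 'r, 'c, 'a) mpcs \<Rightarrow> bool" where
  "fair P \<longleftrightarrow>
     (\<forall>ss as. execution P ss as \<longrightarrow> (\<forall>Q\<in>signers P. honest P Q ss \<longrightarrow> fair_for P Q ss as))"

end

theory Submission
  imports Defs
begin

text \<open>
  Assume that no path realises the order \<open>P\<^sub>1, \<dots>, P\<^sub>k\<^sub>-\<^sub>1\<close> before \<open>v\<close>. Then the signers other than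
  \<open>r(v)\<close> can chain aborts. For each \<open>i\<close> let \<open>P\<^sub>i\<close> exit at a minimal vertex \<open>u\<^sub>i\<close> of its own that is
  either reachable from \<open>I\<close> along \<open>P\<^sub>1, \<dots>, P\<^sub>i\<close> or not in the past of \<open>v\<close> (\<open>u\<^sub>1\<close> can
  be taken in the initial set, which earns the first abort), and let \<open>r(v)\<close>, having
  sent its signature at \<open>v\<close>, exit at a minimal vertex of its own that is not in \<open>v\<close> and its past.
  Evidence that \<open>P\<^sub>i\<close> continued after \<open>u\<^sub>i\<close>, submitted at \<open>u\<^sub>i\<^sub>+\<^sub>1\<close> or before, would extend the reachable
  order by one signer at a vertex that was passed over as unreachable. So each time the TTP sees an
  apparently honest predecessor, and it never revokes the initial abort, although the signature of
  \<open>r(v)\<close> is out.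

  If \<open>v\<close> is in the end set, or if all vertices of some \<open>P\<^sub>i\<close> are in the past of \<open>v\<close>, the attack is not
  available, but then an end vertex lies at or before \<open>v\<close>; it depends on an earlier signing vertex,
  from which the claim is inherited by induction along the causal order.
\<close>


section \<open>Sequences of roles along paths\<close>

lemma subseq_snoc_notin: "subseq xs (ys @ [y]) \<Longrightarrow> y \<notin> set xs \<Longrightarrow> subseq xs ys"
proof (induction ys arbitrary: xs)
  case Nil
  then show ?case by (metis append_Nil list.set_intros(1) list_emb_Nil list_emb_Nil2 neq_Nil_conv
        subseq_Cons2' subseq_Cons2_iff)
next
  case (Cons z ys)
  show ?case
  proof (cases xs)
    case Nil
    then show ?thesis by simp
  next
    case (Cons x xs')
    then show ?thesis using Cons.IH[of xs] Cons.IH[of xs'] Cons.prems by (auto split: if_splits)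
  qed
qed

text \<open>Stated for arbitrary lists, so that prefixes of the order can be tracked from vertex to
  vertex.\<close>

definition reach :: "('v, 'r, 'm, 'z) dag_protocol_scheme \<Rightarrow> 'v set \<Rightarrow> 'r list \<Rightarrow> 'v \<Rightarrow> bool" where
  "reach P I qs w \<longleftrightarrow> (\<exists>xs\<in>seq P I w. subseq qs xs)"

lemma reach_start:
  assumes "w \<in> I" "w \<in> verts P"
  shows "reach P I [role P w] w"
proof -
  have "[w] \<in> path P I w" using assms by (simp add: path_def)
  then have "map (role P) [w] \<in> seq P I w" unfolding seq_def by (rule imageI)
  then show ?thesis by (auto simp: reach_def)
qed

lemma reach_append_left:
  assumes "reach P I (qs @ rs) w"
  shows "reach P I qs w"
  using assms subseq_order.order_trans[OF prefix_imp_subseq[OF prefixI[OF refl]]]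
  unfolding reach_def by blast

text \<open>The role list of a path to \<open>w\<close> ends with \<open>role P w\<close>. Since
  \<open>qs\<close> avoids that role, its embedding leaves the last position free.\<close>

lemma reach_snoc_self:
  assumes "reach P I qs w" "role P w \<notin> set qs"
  shows "reach P I (qs @ [role P w]) w"
proof -
  obtain vs where vs: "vs \<in> path P I w" "subseq qs (map (role P) vs)"
    using assms by (auto simp: reach_def seq_def)
  then obtain us where us: "vs = us @ [w]"
    using append_butlast_last_id[of vs] that[of "butlast vs"] by (auto simp: path_def)
  then have "subseq qs (map (role P) us @ [role P w])"
    using vs(2) by simp
  then have "subseq qs (map (role P) us)"
    using assms(2) by (rule subseq_snoc_notin)
  then have "subseq (qs @ [role P w]) (map (role P) vs)"
    by (simp add: us list_emb_append_mono)
  then show ?thesis using vs(1) by (auto simp: reach_def seq_def)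
qed

lemma path_edge:
  assumes "vs \<in> path P I w" "(w, w') \<in> edges P" "edges P \<subseteq> verts P \<times> verts P"
  shows "vs @ [w'] \<in> path P I w'"
  using assms by (auto simp: path_def successively_append_iff)

lemma reach_edge:
  assumes "reach P I qs w" "(w, w') \<in> edges P" "edges P \<subseteq> verts P \<times> verts P"
  shows "reach P I qs w'" and "reach P I (qs @ [role P w']) w'"
proof -
  obtain vs where vs: "vs \<in> path P I w" "subseq qs (map (role P) vs)"
    using assms by (auto simp: reach_def seq_def)
  have "map (role P) (vs @ [w']) \<in> seq P I w'"
    unfolding seq_def using path_edge[OF vs(1) assms(2,3)] by (rule imageI)
  moreover have "subseq (qs @ [role P w']) (map (role P) (vs @ [w']))"
    using vs(2) by (simp add: list_emb_append_mono)
  ultimately show "reach P I (qs @ [role P w']) w'" unfolding reach_def by blast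
  then show "reach P I qs w'" by (rule reach_append_left)
qed

lemma reach_rtrancl:
  assumes "(w, w') \<in> (edges P)\<^sup>*" "reach P I qs w" "edges P \<subseteq> verts P \<times> verts P"
  shows "reach P I qs w'"
  using assms by (induction rule: rtrancl_induct) (auto intro: reach_edge)

lemma reach_snoc:
  assumes "(w, w') \<in> (edges P)\<^sup>+" "reach P I qs w" "edges P \<subseteq> verts P \<times> verts P"
  shows "reach P I (qs @ [role P w']) w'"
  using tranclD2[OF assms(1)] assms(2,3) reach_edge(2) reach_rtrancl by metis


section \<open>Executions up to a causally closed set\<close>

lemma prec_mono: "E' \<subseteq> E \<Longrightarrow> prec E' x y \<Longrightarrow> prec E x y"
  by (induction E' x y rule: prec.induct) (auto dest: trancl_mono rtrancl_mono[THEN subsetD])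

lemma events_mono: "V' \<subseteq> V \<Longrightarrow> E' \<subseteq> E \<Longrightarrow> events V' E' \<subseteq> events V E"
  by (auto simp: events_def)

lemma causally_closed_subgraph:
  assumes "causally_closed V E S" "V' \<subseteq> V" "E' \<subseteq> E"
  shows "causally_closed V' E' (S \<inter> events V' E')"
  using assms(1) events_mono[OF assms(2,3)] prec_mono[OF assms(3)]
  unfolding causally_closed_def by blast

definition past :: "('v \<times> 'v) set \<Rightarrow> 'v \<Rightarrow> 'v set" where
  "past E v = {u. (u, v) \<in> E\<^sup>+}"

text \<open>
  A natural number that strictly increases along \<open>prec\<close> on the events of a finite acyclic graph, so
  that closed sets can be built up in the order of increasing rank.
\<close>

fun rank :: "('v \<times> 'v) set \<Rightarrow> 'v event \<Rightarrow> nat" where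
  "rank E (Vertex v) = 2 * card (past E v)"
| "rank E (Arc (v, w)) = Suc (2 * card (past E v))"

lemma card_past_less:
  assumes "finite E" "acyclic E" "(u, v) \<in> E\<^sup>+"
  shows "card (past E u) < card (past E v)"
proof (rule psubset_card_mono)
  have "past E v \<subseteq> fst ` E"
  proof
    fix u assume "u \<in> past E v"
    then obtain w where "(u, w) \<in> E" unfolding past_def by (metis mem_Collect_eq tranclD)
    then show "u \<in> fst ` E" by (rule rev_image_eqI) simp
  qed
  then show "finite (past E v)" using assms(1) finite_subset by blast
  have "past E u \<subseteq> past E v" using assms(3) by (auto simp: past_def)
  moreover have "u \<in> past E v" "u \<notin> past E u" using assms(2,3) by (auto simp: past_def acyclic_def)
  ultimately show "past E u \<subset> past E v" by blast
qed

lemma card_past_le: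
  assumes "finite E" "acyclic E" "(u, v) \<in> E\<^sup>*"
  shows "card (past E u) \<le> card (past E v)"
  using assms card_past_less[OF assms(1,2)] by (metis le_less rtrancl_eq_or_trancl)

text \<open>An arc gets the odd number just above its source, and its target has a strictly larger
  past, hence at least the next even number.\<close>

lemma rank_less:
  assumes "finite E" "acyclic E" "x \<in> events V E" "y \<in> events V E" "prec E x y"
  shows "rank E x < rank E y"
proof -
  note less = card_past_less[OF assms(1,2)] and le = card_past_le[OF assms(1,2)]
  have arc: "card (past E a) < card (past E b)" if "(a, c) \<in> E" "(c, b) \<in> E\<^sup>*" for a b c
    using less[OF rtrancl_into_trancl2[OF that]] .
  show ?thesis
  proof (cases x)
    case (Vertex v)
    then show ?thesis using assms(5) less le by (cases y) (auto simp: less_Suc_eq_le)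
  next
    case (Arc f)
    obtain a b where f: "f = (a, b)" by fastforce
    then have "(a, b) \<in> E" using assms(3) Arc by (auto simp: events_def)
    from arc[OF this] show ?thesis using assms(5) Arc f by (cases y) fastforce+
  qed
qed

lemma execution_Nil: "execution P [{}] []"
  by (simp add: execution_def)

lemma execution_snoc:
  assumes "execution P ss as" "step P (last ss) a s"
  shows "execution P (ss @ [s]) (as @ [a])"
proof -
  have len: "length ss = Suc (length as)" using assms(1) by (simp add: execution_def)
  then have "ss \<noteq> []" by auto
  then have l: "last ss = ss ! length as" using len by (simp add: last_conv_nth)
  have "step P ((ss @ [s]) ! i) ((as @ [a]) ! i) ((ss @ [s]) ! Suc i)" if "i < Suc (length as)" for i
    using assms that len l by (cases "i = length as") (auto simp: execution_def nth_append)
  then show ?thesis using assms len by (auto simp: execution_def nth_append)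
qed

section \<open>Structure of the protocol graph\<close>

locale mpcs_protocol =
  fixes P :: "('v, 'r, 'c, 'a) mpcs"
  assumes protocol: "dag_mpcs_protocol P"
begin

abbreviation "V \<equiv> verts P"
abbreviation "E \<equiv> edges P"
abbreviation "T \<equiv> ttp_vertex P"

lemmas protocol_conjs = protocol[unfolded dag_mpcs_protocol_def]

lemma spec: "dag_protocol_spec P"
  using protocol_conjs by (rule conjunct1)

lemma edges_sub: "E \<subseteq> V \<times> V"
  and acyclic_edges: "acyclic E"
  and finite_verts: "finite V"
  using spec unfolding dag_protocol_spec_def by blast+

lemma finite_edges: "finite E"
  using edges_sub finite_verts by (meson finite_SigmaI finite_subset)

lemma finite_events: "finite (events V E)"
  by (simp add: events_def finite_verts finite_edges)

lemma ttp_notin_signers: "ttp P \<notin> signers P"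
proof -
  have "signers P \<subseteq> roles P" using protocol_conjs by (elim conjE)
  moreover have "ttp P \<notin> roles P" using spec unfolding dag_protocol_spec_def by (elim conjE)
  ultimately show ?thesis by blast
qed

lemma ttp_vertex: "T \<in> V" "role P T = ttp P"
proof -
  have "\<exists>!v. v \<in> V \<and> role P v = ttp P" using protocol_conjs by (elim conjE)
  from theI'[OF this] show "T \<in> V" "role P T = ttp P" unfolding ttp_vertex_def by blast+
qed

lemma edge_to_ttp: "v \<in> V \<Longrightarrow> v \<noteq> T \<Longrightarrow> (v, T) \<in> E"
  and role_signer: "v \<in> V \<Longrightarrow> v \<noteq> T \<Longrightarrow> role P v \<in> signers P"
proof -
  have "\<forall>v\<in>V - {T}. (v, T) \<in> E \<and> role P v \<in> signers P" using protocol_conjs by (elim conjE)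
  then show "v \<in> V \<Longrightarrow> v \<noteq> T \<Longrightarrow> (v, T) \<in> E"
    and "v \<in> V \<Longrightarrow> v \<noteq> T \<Longrightarrow> role P v \<in> signers P" by blast+
qed

lemma label_edge: "(v, w) \<in> E \<Longrightarrow> label P (v, w) = edge_label P v w"
proof -
  have "\<forall>(v, w)\<in>E. label P (v, w) = edge_label P v w" using protocol_conjs by (elim conjE)
  then show "(v, w) \<in> E \<Longrightarrow> label P (v, w) = edge_label P v w" by blast
qed

lemma reply_ttp: "ms \<noteq> [] \<Longrightarrow> reply P ms = ttp_answer P ms"
proof -
  have "\<forall>ms. ms \<noteq> [] \<longrightarrow> reply P ms = ttp_answer P ms" using protocol_conjs by (elim conjE)
  then show "ms \<noteq> [] \<Longrightarrow> reply P ms = ttp_answer P ms" by blast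
qed

lemma trancl_verts: "(u, v) \<in> E\<^sup>+ \<Longrightarrow> u \<in> V \<and> v \<in> V"
  using trancl_subset_Sigma[OF edges_sub] by blast

lemma no_cycle: "(u, u) \<notin> E\<^sup>+"
  using acyclic_edges by (simp add: acyclic_def)

lemma ttp_sink: "(T, v) \<notin> E"
proof
  assume e: "(T, v) \<in> E"
  then have "v \<noteq> T" using no_cycle by blast
  moreover have "v \<in> V" using e edges_sub by blast
  ultimately have "(v, T) \<in> E" by (rule edge_to_ttp[rotated])
  with e show False using no_cycle by (meson trancl.simps)
qed

lemma ttp_sink_trancl: "(T, v) \<notin> E\<^sup>+"
  using ttp_sink tranclD by metis

lemma ttp_sink_rtrancl: "(T, v) \<in> E\<^sup>* \<Longrightarrow> v = T"
  using ttp_sink_trancl by (metis rtrancl_eq_or_trancl)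

lemma role_source: "(v, w) \<in> E \<Longrightarrow> v \<in> V \<and> v \<noteq> T \<and> role P v \<in> signers P"
  using edges_sub ttp_sink role_signer by blast

lemma exit_edge_iff: "(v, w) \<in> exit_edges P \<longleftrightarrow> v \<in> V \<and> v \<noteq> T \<and> w = T"
proof
  assume "(v, w) \<in> exit_edges P"
  then have e: "(v, w) \<in> E" "label P (v, w) = Exit" by (auto simp: exit_edges_def)
  then have "w = T" using label_edge[OF e(1)] by (auto simp: edge_label_def split: if_splits)
  then show "v \<in> V \<and> v \<noteq> T \<and> w = T" using role_source[OF e(1)] by blast
next
  assume v: "v \<in> V \<and> v \<noteq> T \<and> w = T"
  then have "role P v \<noteq> role P T" using role_signer ttp_notin_signers ttp_vertex by metis
  moreover have "(v, T) \<in> E" using v edge_to_ttp by blast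
  moreover from label_edge[OF this] have "label P (v, T) = Exit"
    using calculation by (simp add: edge_label_def)
  ultimately show "(v, w) \<in> exit_edges P" using v by (simp add: exit_edges_def)
qed

lemma message_edgeD:
  assumes "(v, w) \<in> message_edges P"
  shows "(v, w) \<in> E" "w \<noteq> T" "role P v \<noteq> role P w" "v \<in> V" "v \<noteq> T" "w \<in> V"
    "role P v \<in> signers P" "role P w \<in> signers P"
proof -
  show e: "(v, w) \<in> E" using assms by (auto simp: message_edges_def)
  obtain m where "edge_label P v w = Msg m" using assms label_edge by (auto simp: message_edges_def)
  then show w: "w \<noteq> T" "role P v \<noteq> role P w" by (auto simp: edge_label_def split: if_splits)
  show "v \<in> V" "v \<noteq> T" "role P v \<in> signers P" using role_source[OF e] by auto
  show "w \<in> V" using e edges_sub by auto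
  then show "role P w \<in> signers P" using w role_signer by blast
qed

lemma not_prec_self: "x \<in> events V E \<Longrightarrow> \<not> prec E x x"
  using rank_less[OF finite_edges acyclic_edges, of x V x] by blast

text \<open>Induction on the size: a last event is split off, the rest is executed first, and
  closedness supplies what the transition for that event needs. The intermediate states stay closed,
  as closed executions and honesty demand.\<close>

lemma closed_set_execution:
  assumes "causally_closed V E S" "Arc ` exit_edges P \<inter> S = {}"
  shows "\<exists>ss as. execution P ss as \<and> last ss = S \<and> (\<forall>a\<in>set as. \<not> is_ExitStep a) \<and>
    (\<forall>s\<in>set ss. causally_closed V E s \<and> s \<subseteq> S)"
proof -
  have "finite S" using assms(1) finite_events finite_subset by (auto simp: causally_closed_def)
  then show ?thesis using assms
  proof (induction "card S" arbitrary: S)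
    case 0
    then have "S = {}" by simp
    then show ?case using 0 execution_Nil by (intro exI[of _ "[{}]"] exI[of _ "[]"]) auto
  next
    case (Suc n)
    have ne: "S \<noteq> {}" using Suc(2) by auto
    have sub: "S \<subseteq> events V E" using Suc.prems by (auto simp: causally_closed_def)
    \<comment> \<open>No event of \<open>S\<close> depends on one of maximal rank, so its removal
      keeps the set closed.\<close>
    obtain x where x: "x \<in> S" and mx: "\<forall>y\<in>S. rank E y \<le> rank E x"
    proof -
      have "Max (rank E ` S) \<in> rank E ` S" using ne Suc.prems(1) by (intro Max_in) auto
      then obtain x where "x \<in> S" "rank E x = Max (rank E ` S)" by auto
      then show ?thesis using that[of x] Suc.prems(1) by simp
    qed
    let ?S = "S - {x}"
    have xe: "x \<in> events V E" using x sub by blast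
    have xS: "card ?S = n" "Arc ` exit_edges P \<inter> ?S = {}"
      using Suc.hyps(2) Suc.prems x by auto
    have cl: "causally_closed V E ?S"
    proof -
      have "y \<in> ?S" if "z \<in> ?S" "y \<in> events V E" "prec E y z" for y z
      proof -
        have "z \<in> events V E" using that(1) sub by blast
        then have "rank E y < rank E z" using that by (intro rank_less[OF finite_edges acyclic_edges])
        moreover have "rank E z \<le> rank E x" using that(1) mx by blast
        ultimately have "y \<noteq> x" by auto
        moreover have "y \<in> S" using that Suc.prems(2) by (auto simp: causally_closed_def)
        ultimately show ?thesis by simp
      qed
      moreover have "?S \<subseteq> events V E" using sub by blast
      ultimately show ?thesis unfolding causally_closed_def by blast
    qed
    obtain ss as where e: "execution P ss as" "last ss = ?S" "\<forall>a\<in>set as. \<not> is_ExitStep a"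
      "\<forall>s\<in>set ss. causally_closed V E s \<and> s \<subseteq> ?S"
      using Suc.hyps(1)[OF xS(1)[symmetric] _ cl xS(2)] Suc.prems(1) by auto
    have pre: "y \<in> ?S" if "prec E y x" "y \<in> events V E" for y
      using that Suc.prems(2) x not_prec_self by (auto simp: causally_closed_def)
    obtain a where a: "enabled P ?S a" "event_of a = x" "\<not> is_ExitStep a"
    proof (cases x)
      case (Vertex v)
      then have "v \<in> V" using xe by (auto simp: events_def)
      moreover have "Arc ` in_edges P v \<subseteq> ?S"
        using pre Vertex by (auto simp: in_edges_def events_def)
      ultimately show ?thesis using Vertex that[of "Recv v"] by simp
    next
      case (Arc f)
      then have f: "f \<in> E" "f \<notin> exit_edges P" using xe x Suc.prems(3) by (auto simp: events_def)
      obtain v w where vw: "f = (v, w)" by fastforce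
      show ?thesis
      proof (cases "label P f")
        case (Msg m)
        then show ?thesis using Arc f that[of "Send f"] by (auto simp: message_edges_def)
      next
        case Epsilon
        have "Vertex v \<in> ?S" using pre[of "Vertex v"] Arc vw f edges_sub by (auto simp: events_def)
        then show ?thesis using Epsilon vw Arc f that[of "EpsilonStep f"] by auto
      next
        case Exit
        then show ?thesis using f by (simp add: exit_edges_def)
      qed
    qed
    have "step P (last ss) a S" using a x e(2) by (auto simp: step_def)
    from execution_snoc[OF e(1) this] show ?case
      using e a(3) Suc.prems(2) by (intro exI[of _ "ss @ [S]"] exI[of _ "as @ [a]"]) auto
  qed
qed

text \<open>All events except \<open>Vertex T\<close> and the exit arcs form a closed set that no
  non-exit transition can extend, so optimism applies to its execution.\<close>

lemma optimistic_EndSet: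
  assumes "optimistic P" "v \<in> V" "v \<noteq> T" "Q \<in> signers P"
  obtains u where "u \<in> EndSet P" "role P u = Q"
proof -
  define S where S_def: "S = events V E - {Vertex T} - Arc ` exit_edges P"
  have "y \<in> S" if x: "x \<in> S" and y: "y \<in> events V E" and yx: "prec E y x" for x y
  proof -
    have no_T: "y \<noteq> Vertex T \<and> (\<forall>a. y \<noteq> Arc (a, T))"
    proof (cases x)
      case (Vertex w)
      then have "w \<noteq> T" using x by (simp add: S_def)
      then have "(T, w) \<notin> E\<^sup>*" using ttp_sink_rtrancl by blast
      then show ?thesis using yx ttp_sink_trancl unfolding Vertex by (metis prec.simps(1,4))
    next
      case (Arc f)
      obtain a b where f: "f = (a, b)" by fastforce
      then have "a \<noteq> T" using x Arc ttp_sink by (auto simp: events_def S_def)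
      then have "(T, a) \<notin> E\<^sup>*" using ttp_sink_rtrancl by blast
      then show ?thesis using yx unfolding Arc f by (metis prec.simps(2,3))
    qed
    moreover have "\<exists>a. f = (a, T)" if "f \<in> exit_edges P" for f
      using that exit_edge_iff[of "fst f" "snd f"] by (metis prod.collapse)
    ultimately have "y \<notin> Arc ` exit_edges P" by (metis imageE)
    then show ?thesis using y no_T by (simp add: S_def)
  qed
  moreover have "S \<subseteq> events V E" unfolding S_def by blast
  ultimately have closed: "causally_closed V E S"
    unfolding causally_closed_def by (intro conjI ballI impI)
  have "Arc ` exit_edges P \<inter> S = {}" unfolding S_def by blast
  from closed_set_execution[OF closed this] obtain ss as where e: "execution P ss as" "last ss = S"
    "\<forall>a\<in>set as. \<not> is_ExitStep a" "\<forall>s\<in>set ss. causally_closed V E s"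
    by blast
  have "\<not> step P S a s'" if "\<not> is_ExitStep a" for a s'
  proof
    assume st: "step P S a s'"
    then have en: "enabled P S a" and new: "event_of a \<notin> S" by (auto simp: step_def)
    show False
    proof (cases a)
      case (Recv u)
      \<comment> \<open>Receiving at \<open>T\<close> is blocked by the missing exit arc of
        \<open>v\<close>; this is the use of a vertex other than \<open>T\<close>.\<close>
      then have "u = T" using en new by (auto simp: events_def S_def)
      moreover have "Arc (v, T) \<notin> S" using exit_edge_iff assms(2,3) unfolding S_def by blast
      moreover have "(v, T) \<in> in_edges P T"
        using edge_to_ttp assms(2,3) by (simp add: in_edges_def)
      ultimately show False using en Recv by auto
    next
      case (Send f)
      then have "f \<in> message_edges P" using en by simp
      then have "Arc f \<in> S" by (auto simp: message_edges_def exit_edges_def events_def S_def)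
      then show False using new Send by simp
    next
      case (EpsilonStep f)
      then have "Arc f \<in> S" using en by (auto simp: exit_edges_def events_def S_def)
      then show False using new EpsilonStep by simp
    next
      case (ExitStep f)
      then show False using that by simp
    qed
  qed
  then have "closed_execution P ss as" using e by (auto simp: closed_execution_def)
  then show ?thesis using assms(1,4) that unfolding optimistic_def by blast
qed

text \<open>
  The honest part of the attack: everything that causally precedes \<open>v\<close>, then \<open>v\<close> itself, and one
  message that carries the signature sent at \<open>v\<close>.
\<close>

definition history :: "'v \<Rightarrow> 'v \<Rightarrow> 'v event set" where
  "history v w = Vertex ` {u. (u, v) \<in> E\<^sup>*} \<union> Arc ` {(a, b). (a, b) \<in> E \<and> (b, v) \<in> E\<^sup>*} \<union> {Arc (v, w)}"

lemma history_closed: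
  assumes "(v, w) \<in> E"
  shows "causally_closed V E (history v w)"
proof -
  have v: "v \<in> V" using assms edges_sub by blast
  have pastV: "u \<in> V" if "(u, v) \<in> E\<^sup>*" for u
    using that v trancl_verts by (metis rtrancl_eq_or_trancl)
  have "history v w \<subseteq> events V E"
    using pastV assms unfolding history_def events_def by blast
  moreover have "y \<in> history v w"
    if x: "x \<in> history v w" and y: "y \<in> events V E" and yx: "prec E y x" for x y
  proof -
    \<comment> \<open>Each event of the history, the extra arc included, sits at or starts from such
      a vertex \<open>u\<close>, and its causal predecessors end at or before
      \<open>u\<close>.\<close>
    obtain u where u: "(u, v) \<in> E\<^sup>*" "x = Vertex u \<or> (\<exists>b. x = Arc (u, b))"
      using x unfolding history_def by (auto intro: converse_rtrancl_into_rtrancl)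
    show ?thesis
    proof (cases y)
      case (Vertex a)
      then have "(a, u) \<in> E\<^sup>*" using u(2) yx by (auto intro: trancl_into_rtrancl)
      then have "(a, v) \<in> E\<^sup>*" using u(1) by (rule rtrancl_trans)
      then show ?thesis using Vertex by (simp add: history_def)
    next
      case (Arc f)
      obtain a b where f: "f = (a, b)" by fastforce
      then have "(b, u) \<in> E\<^sup>*" using Arc u(2) yx by auto
      then have "(b, v) \<in> E\<^sup>*" using u(1) by (rule rtrancl_trans)
      then show ?thesis using Arc f y by (simp add: history_def events_def image_iff)
    qed
  qed
  ultimately show ?thesis unfolding causally_closed_def by blast
qed

text \<open>Enabling an exit depends only on vertices, and exits add only arcs, so exits possible at
  the end of \<open>ss\<close> can all be taken in the given order. The form of the new states
  serves the later check of honesty.\<close>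

lemma exits_execution:
  assumes "execution P ss as" "distinct us"
    and "\<And>u. u \<in> set us \<Longrightarrow> u \<in> V \<and> u \<noteq> T \<and> Arc (u, T) \<notin> last ss"
    and "\<And>u x. u \<in> set us \<Longrightarrow> (x, u) \<in> E\<^sup>+ \<Longrightarrow> role P x = role P u \<Longrightarrow> Vertex x \<in> last ss"
  shows "\<exists>ts. execution P (ss @ ts) (as @ map (\<lambda>u. ExitStep (u, T)) us) \<and>
    last (ss @ ts) = last ss \<union> (\<lambda>u. Arc (u, T)) ` set us \<and>
    (\<forall>t\<in>set ts. \<exists>X\<subseteq>set us. t = last ss \<union> (\<lambda>u. Arc (u, T)) ` X)"
  using assms(2-4)
proof (induction us rule: rev_induct)
  case Nil
  then show ?case using assms(1) by (intro exI[of _ "[]"]) simp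
next
  case (snoc u us)
  obtain ts where ts: "execution P (ss @ ts) (as @ map (\<lambda>u. ExitStep (u, T)) us)"
    "last (ss @ ts) = last ss \<union> (\<lambda>u. Arc (u, T)) ` set us"
    "\<forall>t\<in>set ts. \<exists>X\<subseteq>set us. t = last ss \<union> (\<lambda>u. Arc (u, T)) ` X"
  proof -
    have "distinct us" using snoc.prems(1) by simp
    from snoc.IH[OF this] snoc.prems(2,3) that show ?thesis by fastforce
  qed
  let ?t = "last ss \<union> (\<lambda>u. Arc (u, T)) ` set (us @ [u])"
  have u: "u \<in> V" "u \<noteq> T" "Arc (u, T) \<notin> last ss" using snoc.prems(2)[of u] by auto
  have new: "Arc (u, T) \<notin> last (ss @ ts)" using ts(2) u snoc.prems(1) by auto
  have "enabled P (last (ss @ ts)) (ExitStep (u, T))"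
    using u snoc.prems(3)[of u] ts(2) by (auto simp: exit_edge_iff)
  then have "step P (last (ss @ ts)) (ExitStep (u, T)) ?t"
    using new ts(2) unfolding step_def by auto
  from execution_snoc[OF ts(1) this]
  have "execution P (ss @ ts @ [?t]) (as @ map (\<lambda>u. ExitStep (u, T)) (us @ [u]))" by simp
  moreover have "\<forall>t\<in>set (ts @ [?t]). \<exists>X\<subseteq>set (us @ [u]). t = last ss \<union> (\<lambda>u. Arc (u, T)) ` X"
  proof
    fix t assume "t \<in> set (ts @ [?t])"
    then consider "t \<in> set ts" | "t = ?t" by auto
    then show "\<exists>X\<subseteq>set (us @ [u]). t = last ss \<union> (\<lambda>u. Arc (u, T)) ` X"
    proof cases
      case 1
      then obtain X where "X \<subseteq> set us" "t = last ss \<union> (\<lambda>u. Arc (u, T)) ` X" using ts(3) by blast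
      then show ?thesis by (intro exI[of _ X]) auto
    next
      case 2
      then show ?thesis by blast
    qed
  qed
  ultimately show ?case by (intro exI[of _ "ts @ [?t]"]) simp
qed

text \<open>In the subgraph of \<open>Q\<close> only exit arcs of \<open>Q\<close> itself are
  visible, because \<open>T\<close> has another role. At most one is present, and without it the
  restriction of the closed set \<open>S\<close> remains.\<close>

lemma honest_state_exits:
  assumes S: "causally_closed V E S" "Arc ` exit_edges P \<inter> S = {}"
    and Q: "Q \<in> signers P"
    and X: "X \<subseteq> V - {T}" "\<And>x y. x \<in> X \<Longrightarrow> y \<in> X \<Longrightarrow> role P x = Q \<Longrightarrow> role P y = Q \<Longrightarrow> x = y"
    and new: "\<And>x. x \<in> X \<Longrightarrow> role P x = Q \<Longrightarrow> Vertex x \<notin> S"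
  shows "honest_state P Q (S \<union> (\<lambda>u. Arc (u, T)) ` X)"
proof -
  let ?VQ = "verts_of P Q" and ?EQ = "edges_of P Q"
  let ?W = "events ?VQ ?EQ"
  let ?t = "(S \<union> (\<lambda>u. Arc (u, T)) ` X) \<inter> ?W"
  have EQ: "?EQ \<subseteq> E" by (auto simp: edges_of_def)
  have VQ: "?VQ \<subseteq> V" using EQ edges_sub by (auto simp: verts_of_def)
  have cl: "causally_closed ?VQ ?EQ (S \<inter> ?W)" using causally_closed_subgraph[OF S(1) VQ EQ] .
  have TQ: "role P T \<noteq> Q" using Q ttp_vertex(2) ttp_notin_signers by auto
  have ex: "a \<in> X \<and> role P a = Q \<and> b = T" if "(a, b) \<in> exit_edges P" "Arc (a, b) \<in> ?t" for a b
  proof -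
    have "Arc (a, b) \<notin> S" using that(1) S(2) by blast
    then have "a \<in> X" "b = T" using that(2) by auto
    moreover have "role P a = Q" using that(2) \<open>b = T\<close> TQ by (auto simp: events_def edges_of_def)
    ultimately show ?thesis by simp
  qed
  have exitX: "(x, T) \<in> exit_edges P" if "x \<in> X" for x using that X(1) by (auto simp: exit_edge_iff)
  have "\<forall>e\<in>exit_edges P. \<forall>e'\<in>exit_edges P. Arc e \<in> ?t \<and> Arc e' \<in> ?t \<longrightarrow> e = e'"
    using ex X(2) by (metis surj_pair)
  moreover have "(\<forall>e\<in>exit_edges P. Arc e \<notin> ?t) \<longrightarrow> causally_closed ?VQ ?EQ ?t"
  proof
    assume "\<forall>e\<in>exit_edges P. Arc e \<notin> ?t"
    then have "?t = S \<inter> ?W" using exitX by blast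
    then show "causally_closed ?VQ ?EQ ?t" using cl by simp
  qed
  moreover have "\<forall>(a, b)\<in>exit_edges P. Arc (a, b) \<in> ?t \<longrightarrow>
      Vertex a \<notin> ?t \<and> causally_closed ?VQ ?EQ (?t - {Arc (a, b)})"
  proof clarify
    fix a b assume ab: "(a, b) \<in> exit_edges P" "Arc (a, b) \<in> S \<union> (\<lambda>u. Arc (u, T)) ` X"
      "Arc (a, b) \<in> ?W"
    then have a: "a \<in> X" "role P a = Q" "b = T" using ex[of a b] by auto
    have "Arc (a, b) \<notin> S" using ab(1) S(2) by blast
    then have "?t - {Arc (a, b)} = S \<inter> ?W"
      using a ex exitX X(2) by blast
    then show "Vertex a \<notin> ?t \<and> causally_closed ?VQ ?EQ (?t - {Arc (a, b)})"
      using cl new[OF a(1,2)] by auto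
  qed
  ultimately show ?thesis unfolding honest_state_def Let_def by blast
qed


subsection \<open>The trusted third party under abort chaining\<close>

text \<open>
  \<open>convicted J w\<close> is the test of the TTP: the evidence submitted by the exits at \<open>J\<close> shows that the
  role of \<open>w\<close> sent a message at or after \<open>w\<close>.
\<close>

definition convicted :: "'v set \<Rightarrow> 'v \<Rightarrow> bool" where
  "convicted J w \<longleftrightarrow> (\<exists>(w', x) \<in> (\<Union>u\<in>J. K_prec P u).
     prec E (Vertex w) (Arc (w', x)) \<and> role P w' = role P w)"

lemma convicted_mono: "convicted J w \<Longrightarrow> J \<subseteq> J' \<Longrightarrow> convicted J' w"
  unfolding convicted_def by blast

lemma ttp_step_exit:
  assumes "u \<in> V - {T}"
  shows "ttp_step P st (exit_msg P u) = ttp_handle P st u"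
proof -
  have inj: "exit_msg P u = exit_msg P x \<longleftrightarrow> u = x" for x by (auto simp: exit_msg_def)
  have "(THE x. x \<in> V - {T} \<and> exit_msg P u = exit_msg P x) = u"
  proof (rule the_equality)
    show "u \<in> V - {T} \<and> exit_msg P u = exit_msg P u" using assms by blast
    show "x = u" if "x \<in> V - {T} \<and> exit_msg P u = exit_msg P x" for x using that inj[of x] by simp
  qed
  then show ?thesis using assms unfolding ttp_step_def by auto
qed

text \<open>Each exit after the first finds its immediate predecessor unconvicted, and that one
  signer keeps the TTP from overturning the abort; a later conviction does no harm. The evidence
  \<open>take (Suc (Suc i)) us\<close> ends with the direct successor of \<open>us ! i\<close>. The
  bound on \<open>dishonest\<close> is only an inclusion, since exits in the initial set skip the
  test.\<close>

lemma ttp_aborts: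
  assumes "set us \<subseteq> V - {T}" "distinct (map (role P) us)" "us \<noteq> [] \<Longrightarrow> hd us \<in> InitSet P"
    and "\<And>i. Suc i < length us \<Longrightarrow> \<not> convicted (set (take (Suc (Suc i)) us)) (us ! i)"
  defines "st \<equiv> ttp_run P (map (exit_msg P) us)"
  shows "received st = set us \<and> dishonest st \<subseteq> role P ` {w \<in> set us. convicted (set us) w} \<and>
    decision st = Abort \<and> (us \<noteq> [] \<longrightarrow> ttp_answer P (map (exit_msg P) us) = Abort)"
  using assms(1-4) unfolding st_def
proof (induction us rule: rev_induct)
  case Nil
  then show ?case by (simp add: ttp_run_def ttp_init_def)
next
  case (snoc u us)
  define st where "st = ttp_run P (map (exit_msg P) us)"
  define J where "J = set us \<union> {u}"
  have nc: "\<not> convicted (set (take (Suc (Suc i)) us)) (us ! i)" if "Suc i < length us" for i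
    using snoc.prems(4)[of i] that by (simp add: nth_append)
  have IH: "received st = set us" "dishonest st \<subseteq> role P ` {w \<in> set us. convicted (set us) w}"
    "decision st = Abort"
  proof -
    have "set us \<subseteq> V - {T}" "distinct (map (role P) us)" "us \<noteq> [] \<Longrightarrow> hd us \<in> InitSet P"
      using snoc.prems(1-3) by auto
    from snoc.IH[OF this nc] show "received st = set us"
      "dishonest st \<subseteq> role P ` {w \<in> set us. convicted (set us) w}" "decision st = Abort"
      unfolding st_def by blast+
  qed
  have fresh: "role P u \<notin> role P ` set us" using snoc.prems(2) by auto
  have handle: "ttp_step P st (exit_msg P u) = ttp_handle P st u"
    using snoc.prems(1) by (intro ttp_step_exit) auto
  have run: "ttp_run P (map (exit_msg P) (us @ [u])) = fst (ttp_handle P st u)"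
    using handle by (simp add: ttp_run_def st_def)
  have ans: "ttp_answer P (map (exit_msg P) (us @ [u])) = snd (ttp_handle P st u)"
    using handle by (simp add: ttp_answer_def st_def)
  have dis: "dishonest st \<subseteq> role P ` {w \<in> J. convicted J w}"
  proof -
    have "{w \<in> set us. convicted (set us) w} \<subseteq> {w \<in> J. convicted J w}"
      using convicted_mono[of "set us" _ J] by (auto simp: J_def)
    then show ?thesis using IH(2) by blast
  qed
  have first: "\<not> (role P u \<in> dishonest st \<or> (\<exists>w'\<in>received st. role P w' = role P u))"
  proof -
    have "dishonest st \<subseteq> role P ` set us" using IH(2) by blast
    then have "role P u \<notin> dishonest st" using fresh by blast
    moreover have "role P w \<noteq> role P u" if "w \<in> set us" for w using that fresh by (metis imageI)
    ultimately show ?thesis using IH(1) by blast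
  qed
  have J: "received st \<union> {u} = J" by (simp add: J_def IH(1))
  define D where "D = dishonest st \<union> {role P w | w. w \<in> J \<and>
     (\<exists>(w', x) \<in> (\<Union>u\<in>J. K_prec P u).
        prec E (Vertex w) (Arc (w', x)) \<and> role P w' = role P w)}"
  have D: "D = role P ` {w \<in> J. convicted J w}"
    using dis unfolding D_def convicted_def by blast
  show ?case
  proof (cases "u \<in> InitSet P")
    case True
    then have "ttp_handle P st u = (st\<lparr>received := J\<rparr>, Abort)"
      using first IH unfolding ttp_handle_def Let_def J_def by simp
    then show ?thesis using dis unfolding run ans by (simp add: J_def IH(3))
  next
    case False
    then have "us \<noteq> []" using snoc.prems(3) by auto
    then obtain i where i: "length us = Suc i" by (cases us) auto
    let ?w = "us ! i"
    have w: "?w \<in> set us" using i by simp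
    have "\<not> convicted J ?w" using snoc.prems(4)[of i] i by (simp add: nth_append J_def)
    \<comment> \<open>Roles in \<open>J\<close> are distinct, so the role of \<open>?w\<close>, the
      exit just before \<open>u\<close>, could enter \<open>D\<close> only through a conviction of
      \<open>?w\<close> itself.\<close>
    moreover have "inj_on (role P) J" using snoc.prems(2) by (auto simp: J_def distinct_map)
    ultimately have "role P ?w \<notin> D" using w unfolding D J_def inj_on_def by blast
    moreover have "role P ?w \<noteq> role P u" using fresh w by (metis imageI)
    ultimately have "\<not> (\<forall>w\<in>J. role P w \<notin> D \<longrightarrow> role P w = role P u)" using w J_def by blast
    then have "ttp_handle P st u = (\<lparr>received = J, dishonest = D, decision = Abort\<rparr>, Abort)"
      unfolding ttp_handle_def Let_def if_not_P[OF first] if_not_P[OF False] J D_def[symmetric] IH(3)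
      by (simp only: if_False)
    then show ?thesis unfolding run ans by (simp add: J_def D)
  qed
qed

text \<open>The signer \<open>role P v\<close> is honest, has sent its signature at \<open>v\<close>
  and gets an abort at its exit \<open>last us\<close>. The first and third clauses of fairness
  fail, so the second gives an end vertex in the history. The assumption on earlier vertices of the
  same role enables the exits; \<open>(last us, v) \<notin> E\<^sup>*\<close> keeps
  \<open>last us\<close> unreceived, as honesty requires.\<close>

lemma abort_chain:
  assumes fair: "fair P" and vw: "(v, w) \<in> message_edges P" and v: "v \<in> SigSet P"
    and us: "us \<noteq> []" "set us \<subseteq> V - {T}" "distinct (map (role P) us)" "hd us \<in> InitSet P"
    and nc: "\<And>i. Suc i < length us \<Longrightarrow> \<not> convicted (set (take (Suc (Suc i)) us)) (us ! i)"
    and last: "role P (last us) = role P v" "(last us, v) \<notin> E\<^sup>*"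
    and pre: "\<And>u x. u \<in> set us \<Longrightarrow> (x, u) \<in> E\<^sup>+ \<Longrightarrow> role P x = role P u \<Longrightarrow> (x, v) \<in> E\<^sup>*"
  shows "\<exists>e\<in>EndSet P. (e, v) \<in> E\<^sup>* \<and> role P e = role P v"
proof -
  let ?S = "history v w" and ?Q = "role P v" and ?ex = "map (\<lambda>u. ExitStep (u, T)) us"
  note e = message_edgeD[OF vw]
  have cl: "causally_closed V E ?S" using history_closed e(1) .
  have vT: "(T, v) \<notin> E\<^sup>*" using ttp_sink_rtrancl e(5) by blast
  have noexit: "Arc ` exit_edges P \<inter> ?S = {}"
    using vT e(2) exit_edge_iff unfolding history_def by auto
  obtain ss as where ex: "execution P ss as" "last ss = ?S" "\<forall>a\<in>set as. \<not> is_ExitStep a"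
    "\<forall>s\<in>set ss. causally_closed V E s \<and> s \<subseteq> ?S"
    using closed_set_execution[OF cl noexit] by blast
  have new: "u \<in> V \<and> u \<noteq> T \<and> Arc (u, T) \<notin> last ss" if "u \<in> set us" for u
  proof -
    have u: "u \<in> V" "u \<noteq> T" using that us(2) by auto
    then have "(u, T) \<in> exit_edges P" using exit_edge_iff by simp
    then show ?thesis using u noexit ex(2) by blast
  qed
  have prev: "Vertex x \<in> last ss" if "u \<in> set us" "(x, u) \<in> E\<^sup>+" "role P x = role P u" for u x
    using pre[OF that] ex(2) by (simp add: history_def)
  have "distinct us" using us(3) by (simp add: distinct_map)
  then have "\<exists>ts. execution P (ss @ ts) (as @ ?ex) \<and>
    last (ss @ ts) = last ss \<union> (\<lambda>u. Arc (u, T)) ` set us \<and>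
    (\<forall>t\<in>set ts. \<exists>X\<subseteq>set us. t = last ss \<union> (\<lambda>u. Arc (u, T)) ` X)"
    using new prev by (intro exits_execution[OF ex(1)])
  then obtain ts where ts: "execution P (ss @ ts) (as @ ?ex)"
    "last (ss @ ts) = ?S \<union> (\<lambda>u. Arc (u, T)) ` set us"
    "\<forall>t\<in>set ts. \<exists>X\<subseteq>set us. t = ?S \<union> (\<lambda>u. Arc (u, T)) ` X"
    unfolding ex(2) by blast
  have lastin: "last us \<in> set us" using us(1) by simp
  have unique: "x = last us" if "x \<in> set us" "role P x = ?Q" for x
    using that us(3) last(1) lastin by (metis distinct_map inj_on_def)
  have "honest_state P ?Q t" if "t \<in> set (ss @ ts)" for t
  proof -
    consider "t \<in> set ss" | "t \<in> set ts" using \<open>t \<in> set (ss @ ts)\<close> by auto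
    then show ?thesis
    proof cases
      case 1
      then have "causally_closed V E t" "Arc ` exit_edges P \<inter> t = {}" using ex(4) noexit by blast+
      from honest_state_exits[OF this e(7), of "{}"] show ?thesis by simp
    next
      case 2
      then obtain X where X: "X \<subseteq> set us" "t = ?S \<union> (\<lambda>u. Arc (u, T)) ` X" using ts(3) by blast
      have "Vertex (last us) \<notin> ?S" using last(2) by (auto simp: history_def)
      then show ?thesis unfolding X(2) using X(1) us(2) unique
        by (intro honest_state_exits[OF cl noexit e(7)]) blast+
    qed
  qed
  then have "honest P ?Q (ss @ ts)" by (simp add: honest_def)
  then have fair_for: "fair_for P ?Q (ss @ ts) (as @ ?ex)"
    using fair ts(1) e(7) unfolding fair_def by blast
  have signed: "\<not> (\<forall>(a, b)\<in>message_edges P. Arc (a, b) \<in> last (ss @ ts) \<and> role P a = ?Q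
      \<longrightarrow> a \<notin> SigSet P)"
    using vw v ts(2) by (auto simp: history_def)
  let ?n = "length (as @ ?ex) - 1"
  have lastex: "(as @ ?ex) ! ?n = ExitStep (last us, T)"
    using us(1) last_conv_nth[of "as @ ?ex"] by (simp add: last_map)
  have "[exit_msg P u. ExitStep (u, x) \<leftarrow> as] = []"
    using ex(3) by (induction as) (auto split: transition.splits)
  moreover have "[exit_msg P u. ExitStep (u, x) \<leftarrow> ?ex] = map (exit_msg P) us"
    by (induction us) auto
  moreover have "take (Suc ?n) (as @ ?ex) = as @ ?ex" using us(1) by simp
  ultimately have "reply_at P (as @ ?ex) ?n = reply P (map (exit_msg P) us)"
    unfolding reply_at_def by (simp only: map_append concat_append append_Nil)
  also have "\<dots> = Abort"
    using ttp_aborts[OF us(2,3) us(4) nc] us(1) reply_ttp by simp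
  finally have abort: "reply_at P (as @ ?ex) ?n = Abort" .
  have "(last us, T) \<in> exit_edges P" using lastin us(2) exit_edge_iff by blast
  moreover have "Arc (last us, T) \<in> last (ss @ ts)" using ts(2) lastin by auto
  moreover have "?n < length (as @ ?ex)" using us(1) by simp
  ultimately have "\<not> (\<forall>(a, b)\<in>exit_edges P. Arc (a, b) \<in> last (ss @ ts) \<and> role P a = ?Q \<longrightarrow>
      (\<forall>i<length (as @ ?ex). (as @ ?ex) ! i = ExitStep (a, b) \<longrightarrow> reply_at P (as @ ?ex) i \<noteq> Abort))"
    using abort lastex last(1) by blast
  then obtain u where "u \<in> EndSet P" "Vertex u \<in> last (ss @ ts)" "role P u = ?Q"
    using fair_for signed unfolding fair_for_def by blast
  then show ?thesis using ts(2) by (auto simp: history_def)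
qed

subsection \<open>Initial and final vertices\<close>

lemma trancl_source_not_ttp: "(u, v) \<in> E\<^sup>+ \<Longrightarrow> u \<noteq> T"
  using ttp_sink_trancl by blast

lemma exists_earliest:
  assumes "a \<in> A"
  shows "\<exists>u\<in>A. \<forall>x. (x, u) \<in> E\<^sup>+ \<longrightarrow> x \<notin> A"
proof -
  obtain u where u: "u \<in> A" "\<And>y. y \<in> A \<Longrightarrow> card (past E u) \<le> card (past E y)"
    using ex_has_least_nat[of "\<lambda>u. u \<in> A" a "\<lambda>u. card (past E u)"] assms by blast
  then show ?thesis using card_past_less[OF finite_edges acyclic_edges] by (meson leD)
qed

lemma exists_latest:
  assumes "a \<in> A" "A \<subseteq> V"
  shows "\<exists>u\<in>A. \<forall>x. (u, x) \<in> E\<^sup>+ \<longrightarrow> x \<notin> A"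
proof -
  have "card (past E y) < Suc (card V)" for y
    using trancl_verts finite_verts by (auto simp: past_def less_Suc_eq_le intro!: card_mono)
  then obtain u where u: "u \<in> A" "\<And>y. y \<in> A \<Longrightarrow> card (past E y) \<le> card (past E u)"
    using ex_has_greatest_nat[of "\<lambda>u. u \<in> A" a "\<lambda>u. card (past E u)" "Suc (card V)"] assms by blast
  then show ?thesis using card_past_less[OF finite_edges acyclic_edges] by (meson leD)
qed

text \<open>Along the vertices of one signer \<open>K\<close> only grows, and its sources never have
  roles outside \<open>signers P\<close>, so equality persists.\<close>

lemma EndSet_upward:
  assumes "e \<in> EndSet P" "(e, v) \<in> E\<^sup>*" "role P e = role P v" "v \<in> V" "v \<noteq> T"
  shows "v \<in> EndSet P"
proof -
  have "K P e \<subseteq> K P v" using assms(2,3) by (auto simp: K_def intro: rtrancl_trans)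
  then have "{role P w | w v'. (w, v') \<in> K P e \<and> w \<in> SigSet P} \<union> {role P e} \<subseteq>
      {role P w | w v'. (w, v') \<in> K P v \<and> w \<in> SigSet P} \<union> {role P v}"
    using assms(3) by blast
  moreover have "{role P w | w v'. (w, v') \<in> K P v \<and> w \<in> SigSet P} \<union> {role P v} \<subseteq> signers P"
    using message_edgeD(7) role_signer[OF assms(4,5)] by (auto simp: K_def)
  ultimately show ?thesis using assms(1,4,5) unfolding EndSet_def by blast
qed

text \<open>Another signer is covered at an end vertex only by a message from one of its signing
  vertices. This moves the induction back in time.\<close>

lemma EndSet_SigSet:
  assumes "e \<in> EndSet P" "Q \<in> signers P" "Q \<noteq> role P e"
  obtains q where "q \<in> SigSet P" "role P q = Q" "(q, e) \<in> E\<^sup>+"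
proof -
  have "Q \<in> {role P w | w v'. (w, v') \<in> K P e \<and> w \<in> SigSet P}"
    using assms by (auto simp: EndSet_def)
  then obtain w v' where w: "role P w = Q" "(w, v') \<in> K P e" "w \<in> SigSet P" by blast
  then have "(w, v') \<in> E" "(v', e) \<in> E\<^sup>*" using message_edgeD(1) by (auto simp: K_def)
  then have "(w, e) \<in> E\<^sup>+" by (rule rtrancl_into_trancl2)
  then show ?thesis using that w by blast
qed

lemma InitSet_downward:
  assumes "u \<in> InitSet P" "(x, u) \<in> E\<^sup>+" "role P x = role P u"
  shows "x \<in> InitSet P"
proof -
  have x: "x \<in> V" "x \<noteq> T" using trancl_verts trancl_source_not_ttp assms(2) by blast+
  have "K_prec P x \<subseteq> K_prec P u" using assms(2,3) by (auto simp: K_prec_def K_def)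
  then have "{role P w | w v'. (w, v') \<in> K_prec P x} \<union> {role P x} \<subseteq>
      {role P w | w v'. (w, v') \<in> K_prec P u} \<union> {role P u}"
    using assms(3) by blast
  moreover have "u \<in> V" "u \<noteq> T" using assms(1) by (auto simp: InitSet_def)
  then have "{role P w | w v'. (w, v') \<in> K_prec P u} \<union> {role P u} \<subseteq> signers P"
    using message_edgeD(7) role_signer by (auto simp: K_prec_def K_def)
  ultimately show ?thesis using assms(1) x unfolding InitSet_def by blast
qed

text \<open>A minimal vertex of the role has an empty \<open>K_prec\<close>, so only its own signer
  is covered there.\<close>

lemma InitSet_role:
  assumes "x \<in> V" "x \<noteq> T" "signers P \<noteq> {role P x}"
  obtains u where "u \<in> InitSet P" "role P u = role P x"
proof -
  obtain u where u: "u \<in> {u \<in> V. role P u = role P x}"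
    "\<forall>y. (y, u) \<in> E\<^sup>+ \<longrightarrow> y \<notin> {u \<in> V. role P u = role P x}"
    using exists_earliest[of x "{u \<in> V. role P u = role P x}"] assms(1) by blast
  have "u \<noteq> T" using u(1) role_signer[OF assms(1,2)] ttp_notin_signers ttp_vertex(2) by auto
  moreover have "K_prec P u = {}" using u trancl_verts by (fastforce simp: K_prec_def K_def)
  ultimately have "u \<in> InitSet P" using u(1) assms(3) by (auto simp: InitSet_def)
  then show ?thesis using u(1) that by blast
qed

section \<open>The causal induction and the choice of the exit vertices\<close>

lemma reach_trancl: "reach P I qs u \<Longrightarrow> (u, v) \<in> E\<^sup>+ \<Longrightarrow> reach P I qs v"
  using reach_rtrancl[OF trancl_into_rtrancl _ edges_sub] .

text \<open>Strong induction on the size of the causal past of \<open>v\<close>. The order varies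
  too, since an earlier signing vertex may belong to another signer, whose orders permute a
  different set.\<close>

lemma SigSet_reach:
  assumes "optimistic P" "fair P"
    and I: "I = {u \<in> InitSet P. \<forall>w\<in>V. (u, w) \<in> E\<^sup>+ \<and> role P u = role P w \<longrightarrow> w \<notin> InitSet P}"
    and "v \<in> SigSet P" "distinct Ps" "set Ps = signers P - {role P v}"
  shows "reach P I Ps v"
  using assms(4-6)
proof (induction "card (past E v)" arbitrary: v Ps rule: less_induct)
  case less
  let ?Q = "role P v"
  obtain w where vw: "(v, w) \<in> message_edges P" using less.prems(1) by (auto simp: SigSet_def)
  note e = message_edgeD[OF vw]
  have IH: "reach P I Rs q"
    if "q \<in> SigSet P" "(q, v) \<in> E\<^sup>+" "distinct Rs" "set Rs = signers P - {role P q}" for q Rs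
    using less.hyps card_past_less[OF finite_edges acyclic_edges] that by blast
  have "role P w \<in> set Ps" using less.prems(3) e(3,8) by auto
  then have ne: "Ps \<noteq> []" by auto
  show ?case
  proof (cases "v \<in> EndSet P")
    case True
    obtain Rs R where R: "Ps = Rs @ [R]" using ne by (metis rev_exhaust)
    then have "R \<in> signers P" "R \<noteq> ?Q" using less.prems(3) by auto
    then obtain q where q: "q \<in> SigSet P" "role P q = R" "(q, v) \<in> E\<^sup>+"
      using EndSet_SigSet[OF True] by metis
    \<comment> \<open>Orders at \<open>q\<close> omit \<open>R\<close> but contain
      \<open>?Q\<close>. In \<open>?Q # Rs\<close> the head is then dropped, and \<open>R\<close> is
      appended at \<open>q\<close> itself.\<close>
    have "distinct (?Q # Rs)" "set (?Q # Rs) = signers P - {role P q}"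
      using less.prems(2,3) e(7) unfolding R q(2) by auto
    from IH[OF q(1,3) this] have "reach P I (?Q # Rs) q" .
    then have "reach P I Rs q" unfolding reach_def by (meson subseq_Cons')
    then have "reach P I (Rs @ [role P q]) q"
      using less.prems(2) by (intro reach_snoc_self) (simp_all add: R q(2))
    then show ?thesis unfolding R q(2) using q(3) by (rule reach_trancl)
  next
    case False
    show ?thesis
    proof (rule ccontr)
      assume nr: "\<not> reach P I Ps v"
      define n where "n = length Ps"
      \<comment> \<open>\<open>D i\<close> collects the vertices before \<open>v\<close> not reached
        along the first \<open>i + 1\<close> signers, \<open>Ps ! i\<close> included. The exit of
        \<open>Ps ! i\<close> will be a minimal vertex of its own outside
        \<open>D i\<close>.\<close>
      define D where "D i u \<longleftrightarrow> (u, v) \<in> E\<^sup>+ \<and> \<not> reach P I (take (Suc i) Ps) u" for i u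
      have PsI: "Ps ! i \<in> signers P" "Ps ! i \<noteq> ?Q" if "i < n" for i
        using nth_mem[of i Ps] that less.prems(3) unfolding n_def by auto
      have endset: "\<exists>u\<in>EndSet P. role P u = R" if "R \<in> signers P" for R
        using optimistic_EndSet[OF assms(1) e(4,5) that] by blast
      have late: "\<exists>u. u \<in> EndSet P \<and> role P u = Ps ! i \<and> (u, v) \<notin> E\<^sup>+" if i: "i < n" for i
      proof (rule ccontr)
        assume c: "\<not> ?thesis"
        obtain u where u: "u \<in> EndSet P" "role P u = Ps ! i" using endset PsI(1)[OF i] by blast
        then have uv: "(u, v) \<in> E\<^sup>+" using c by blast
        \<comment> \<open>An end vertex of \<open>Ps ! i\<close> needs a signature of
          \<open>?Q\<close>; its vertex \<open>q\<close> would precede \<open>v\<close> and realise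
          \<open>Ps\<close> by induction.\<close>
        obtain q where q: "q \<in> SigSet P" "role P q = ?Q" "(q, u) \<in> E\<^sup>+"
          using EndSet_SigSet[OF u(1) e(7)] PsI(2)[OF i] u(2) by metis
        have qv: "(q, v) \<in> E\<^sup>+" using q(3) uv by simp
        have "reach P I Ps q" using IH[OF q(1) qv less.prems(2)] less.prems(3) q(2) by simp
        then show False using nr qv reach_trancl by blast
      qed
      have "\<exists>u. u \<in> V - {T} \<and> role P u = Ps ! i \<and>
          (\<forall>x. (x, u) \<in> E\<^sup>+ \<and> role P x = Ps ! i \<longrightarrow> D i x) \<and> \<not> D i u \<and>
          (i = 0 \<longrightarrow> u \<in> InitSet P)" if i: "i < n" for i
      proof (cases "i = 0")
        case True
        \<comment> \<open>The first exit has to be initial. A latest initial vertex \<open>l\<close>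
          lies in \<open>I\<close> and is reached along its own role alone, so it is outside
          \<open>D 0\<close>.\<close>
        obtain x where x: "x \<in> EndSet P" "role P x = Ps ! 0" using endset PsI(1) i True by blast
        have xV: "x \<in> V" "x \<noteq> T" using x(1) by (auto simp: EndSet_def)
        have "signers P \<noteq> {role P x}" using e(7) PsI(2)[OF i] True x(2) by auto
        then obtain y where "y \<in> {y \<in> InitSet P. role P y = Ps ! 0}"
          using InitSet_role[OF xV] x(2) by auto
        moreover have "{y \<in> InitSet P. role P y = Ps ! 0} \<subseteq> V" by (auto simp: InitSet_def)
        ultimately obtain l where l: "l \<in> InitSet P" "role P l = Ps ! 0"
          "\<And>z. (l, z) \<in> E\<^sup>+ \<Longrightarrow> role P z = Ps ! 0 \<Longrightarrow> z \<notin> InitSet P"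
          using exists_latest[of y "{y \<in> InitSet P. role P y = Ps ! 0}"] by blast
        have "l \<in> I" unfolding I using l by auto
        moreover have "l \<in> V" using l(1) by (auto simp: InitSet_def)
        ultimately have "reach P I [Ps ! 0] l" using reach_start[of l I P] l(2) by simp
        then have "\<not> D 0 l" using ne by (cases Ps) (auto simp: D_def)
        then obtain u where u: "u \<in> InitSet P" "role P u = Ps ! 0" "\<not> D 0 u"
          "\<And>x. (x, u) \<in> E\<^sup>+ \<Longrightarrow> x \<in> InitSet P \<Longrightarrow> role P x = Ps ! 0 \<Longrightarrow> D 0 x"
          using exists_earliest[of l "{u \<in> InitSet P. role P u = Ps ! 0 \<and> \<not> D 0 u}"] l by blast
        \<comment> \<open>Downward closure of the initial set makes minimality among initial
          vertices extend to all vertices of this signer.\<close>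
        have "D 0 x" if "(x, u) \<in> E\<^sup>+" "role P x = Ps ! 0" for x
          using u(4)[OF that(1) _ that(2)] InitSet_downward[OF u(1) that(1)] that(2) u(2) by simp
        then show ?thesis using u(1-3) True by (intro exI[of _ u]) (auto simp: InitSet_def)
      next
        case False
        \<comment> \<open>Not being before \<open>v\<close>, this end vertex is outside
          \<open>D i\<close>, so there is a minimal such vertex.\<close>
        obtain l where l: "l \<in> EndSet P" "role P l = Ps ! i" "(l, v) \<notin> E\<^sup>+" using late[OF i] by blast
        let ?A = "{u \<in> V - {T}. role P u = Ps ! i \<and> \<not> D i u}"
        have "l \<in> ?A" using l by (auto simp: EndSet_def D_def)
        from exists_earliest[OF this]
        obtain u where u: "u \<in> ?A" "\<And>x. (x, u) \<in> E\<^sup>+ \<Longrightarrow> x \<notin> ?A" by blast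
        have "D i x" if "(x, u) \<in> E\<^sup>+" "role P x = Ps ! i" for x
          using u(2)[OF that(1)] that trancl_verts trancl_source_not_ttp by blast
        then show ?thesis using u(1) False by blast
      qed
      then have "\<exists>f. \<forall>i<n. f i \<in> V - {T} \<and> role P (f i) = Ps ! i \<and>
          (\<forall>x. (x, f i) \<in> E\<^sup>+ \<and> role P x = Ps ! i \<longrightarrow> D i x) \<and> \<not> D i (f i) \<and>
          (i = 0 \<longrightarrow> f i \<in> InitSet P)"
        by (intro choice) blast
      then obtain f where f: "\<And>i. i < n \<Longrightarrow> f i \<in> V - {T}" "\<And>i. i < n \<Longrightarrow> role P (f i) = Ps ! i"
        "\<And>i x. i < n \<Longrightarrow> (x, f i) \<in> E\<^sup>+ \<Longrightarrow> role P x = Ps ! i \<Longrightarrow> D i x"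
        "\<And>i. i < n \<Longrightarrow> \<not> D i (f i)" "n > 0 \<Longrightarrow> f 0 \<in> InitSet P"
        by blast
      obtain l where l: "l \<in> EndSet P" "role P l = ?Q" using endset[OF e(7)] by blast
      let ?A = "{u \<in> V - {T}. role P u = ?Q \<and> (u, v) \<notin> E\<^sup>*}"
      \<comment> \<open>As \<open>v\<close> is not an end vertex, no end vertex of \<open>?Q\<close>
        lies at or before it; so \<open>?Q\<close> still has a vertex at which to exit.\<close>
      have "(l, v) \<notin> E\<^sup>*" using EndSet_upward[OF l(1) _ l(2) e(4,5)] False by blast
      then have "l \<in> ?A" using l by (auto simp: EndSet_def)
      from exists_earliest[OF this]
      obtain v' where v': "v' \<in> ?A" "\<And>x. (x, v') \<in> E\<^sup>+ \<Longrightarrow> x \<notin> ?A" by blast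
      have v'_pre: "(x, v) \<in> E\<^sup>*" if "(x, v') \<in> E\<^sup>+" "role P x = ?Q" for x
        using v'(2)[OF that(1)] that trancl_verts trancl_source_not_ttp by blast
      define us where "us = map f [0..<n] @ [v']"
      have len: "length us = Suc n" by (simp add: us_def)
      have us_nth: "us ! a = (if a = n then v' else f a)" if "a \<le> n" for a
        using that by (auto simp: us_def nth_append)
      have "map (role P) (map f [0..<n]) = Ps" using f(2) by (intro nth_equalityI) (auto simp: n_def)
      then have roles: "map (role P) us = Ps @ [?Q]" using v'(1) by (simp add: us_def)
      have n0: "n > 0" using ne by (simp add: n_def)
      have nc: "\<not> convicted (set (take (Suc (Suc i)) us)) (us ! i)" if i: "Suc i < length us" for i
      proof
        assume "convicted (set (take (Suc (Suc i)) us)) (us ! i)"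
        \<comment> \<open>The evidence is a message sent at or after \<open>us ! i\<close> and
          received at \<open>x\<close>, strictly before the exit vertex \<open>z\<close> of the
          receiver. Minimality of \<open>z\<close> puts \<open>x\<close> at or before
          \<open>v\<close>.\<close>
        then obtain z w' x where z: "z \<in> set (take (Suc (Suc i)) us)" and wx: "(w', x) \<in> K_prec P z"
          "(us ! i, w') \<in> E\<^sup>*"
          by (auto simp: convicted_def)
        obtain a where a: "a \<le> Suc i" "a \<le> n" "z = us ! a"
        proof -
          obtain a where "a < length (take (Suc (Suc i)) us)" "take (Suc (Suc i)) us ! a = z"
            using z unfolding in_set_conv_nth by blast
          then show ?thesis using that[of a] len by simp
        qed
        have i': "i < n" "us ! i = f i" using i len us_nth by auto
        have x: "(w', x) \<in> E" "(x, z) \<in> E\<^sup>+" "role P x = role P z"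
          using wx(1) message_edgeD(1) by (auto simp: K_prec_def K_def)
        have fx: "(f i, x) \<in> E\<^sup>+" using wx(2) x(1) i' by (metis rtrancl_into_trancl1)
        show False
        proof (cases "a = n")
          case True
          \<comment> \<open>Here \<open>take (Suc i) Ps\<close> is all of \<open>Ps\<close>, so
            \<open>f i\<close>, lying before \<open>v\<close>, would realise the whole
            order.\<close>
          then have "z = v'" "Suc i = n" using a us_nth i' by auto
          then have "(x, v) \<in> E\<^sup>*" using v'_pre x(2,3) v'(1) by auto
          then have fv: "(f i, v) \<in> E\<^sup>+" using fx by (rule trancl_rtrancl_trancl[rotated])
          then have "reach P I Ps (f i)" using f(4)[OF i'(1)] \<open>Suc i = n\<close> by (simp add: D_def n_def)
          then show False using nr fv reach_trancl by blast
        next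
          case False
          then have a': "a < n" "z = f a" using a us_nth by auto
          then have rx: "role P x = Ps ! a" using f(2) x(3) by simp
          then have "D a x" using f(3)[of a x] a' x(2) by simp
          then have Da: "(x, v) \<in> E\<^sup>+" "\<not> reach P I (take (Suc a) Ps) x" by (auto simp: D_def)
          have "(f i, v) \<in> E\<^sup>+" using fx Da(1) by (rule trancl_trans)
          then have ri: "reach P I (take (Suc i) Ps) (f i)" using f(4)[OF i'(1)] by (simp add: D_def)
          show False
          proof (cases "a = Suc i")
            case True
            \<comment> \<open>The role of \<open>x\<close> extends the order reached at
              \<open>f i\<close> by one signer, yet \<open>x\<close> is in
              \<open>D a\<close>.\<close>
            then have "take (Suc a) Ps = take (Suc i) Ps @ [role P x]"
              using a'(1) rx by (simp add: take_Suc_conv_app_nth n_def)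
            then show False using reach_snoc[OF fx ri edges_sub] Da(2) by simp
          next
            case False
            \<comment> \<open>For evidence from \<open>us ! i\<close> itself or an earlier exit, a
              prefix of the order reached at \<open>f i\<close> passes down to
              \<open>x\<close>.\<close>
            then have "a \<le> i" using a(1) by simp
            then have "take (Suc i) Ps = take (Suc a) Ps @ drop (Suc a) (take (Suc i) Ps)"
              by (metis Suc_le_mono append_take_drop_id min.absorb1 take_take)
            then have "reach P I (take (Suc a) Ps) (f i)" using ri reach_append_left by metis
            then show False using reach_trancl[OF _ fx] Da(2) by blast
          qed
        qed
      qed
      have "(x, v) \<in> E\<^sup>*" if u: "u \<in> set us" and x: "(x, u) \<in> E\<^sup>+" "role P x = role P u" for u x
      proof -
        consider i where "i < n" "u = f i" | "u = v'" using u by (auto simp: us_def)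
        then show ?thesis
        proof cases
          case 1
          then have "D i x" using f(2,3) x by simp
          then show ?thesis by (auto simp: D_def)
        next
          case 2
          then show ?thesis using v'_pre v'(1) x by auto
        qed
      qed
      moreover have "hd us \<in> InitSet P" using f(5) n0 by (simp add: us_def hd_append hd_map)
      moreover have "set us \<subseteq> V - {T}" using f(1) v'(1) by (auto simp: us_def)
      moreover have "distinct (map (role P) us)" unfolding roles using less.prems(2,3) by auto
      moreover have "us \<noteq> []" "role P (last us) = ?Q" "(last us, v) \<notin> E\<^sup>*"
        using v'(1) by (auto simp: us_def)
      ultimately obtain d where "d \<in> EndSet P" "(d, v) \<in> E\<^sup>*" "role P d = ?Q"
        using abort_chain[OF assms(2) vw less.prems(1), of us] nc by blast
      then show False using EndSet_upward[OF _ _ _ e(4,5)] False by blast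
    qed
  qed
qed

end

theorem theorem2:
  fixes P :: "('v, 'r, 'c, 'a) mpcs" and I :: "'v set" and v :: 'v
  assumes "dag_mpcs_protocol P" and "optimistic P" and "fair P"
    and "I = {u \<in> InitSet P.
           \<forall>w\<in>verts P. (u, w) \<in> (edges P)\<^sup>+ \<and> role P u = role P w \<longrightarrow> w \<notin> InitSet P}"
    and "v \<in> SigSet P"
  shows "\<forall>Ps \<in> permutations_of_set (signers P - {role P v}). \<exists>xs \<in> seq P I v. subseq Ps xs"
proof
  fix Ps assume "Ps \<in> permutations_of_set (signers P - {role P v})"
  then have Ps: "distinct Ps" "set Ps = signers P - {role P v}"
    by (auto dest: permutations_of_setD)
  have "mpcs_protocol P" using assms(1) by (rule mpcs_protocol.intro)
  from mpcs_protocol.SigSet_reach[OF this assms(2-5) Ps]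
  show "\<exists>xs \<in> seq P I v. subseq Ps xs" by (simp add: reach_def)
qed

end
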